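(* Let $I=[0,\infty)$, let $s\in(0,1]$, let $f,g\in SX((h-s)_2,I)$, let $h$ be super-multiplicative, and let $f,g$ be similarly ordered functions on $I$. Let $a,b\in I$ with $a<b$. If $f,g,fg\in L_1[a,b]$ and $h\in L_1[0,1]$, then $$\frac{1}{(b-a)^2}\int_a^b\int_a^b\int_0^1 f(tx+(1-t)y)\,g(tx+(1-t)y)\,dt\,dx\,dy$$ $$\le \left(\frac{1}{b-a}\int_a^b f(x)g(x)\,dx\right)\left(\int_0^1\left(h^s(t^2)+h^s(t-t^2)\right)dt\right)+\left(\frac{1}{b-a}\int_a^b f(y)g(y)\,dy\right)\left(\int_0^1\left(h^s((1-t)^2)+h^s(t-t^2)\right)dt\right)$$ $$=\left(\frac{1}{b-a}\int_a^b f(x)g(x)\,dx\right)\left(\int_0^1\left(h^s(t)+h^s(1-t)\right)^2dt\right).$$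
   Context: Notation: $h^s(t)=(h(t))^s$. Definition of $SX((h-s)_2,I)$: let $h:J\subset\mathbb{R}\to\mathbb{R}$ be a non-negative function, $h\neq 0$, defined at all points of $[0,1]$ (where it is evaluated), and let $s\in(0,1]$. A function $f:I=[0,\infty)\to\mathbb{R}$ is $(h-s)_2$-convex (in the second sense), written $f\in SX((h-s)_2,I)$, if $f$ is non-negative and for all $u,v\in I$ and $t\in[0,1]$, $$f(tu+(1-t)v)\le h^s(t)f(u)+h^s(1-t)f(v).$$ A function $h:J\to\mathbb{R}$ is super-multiplicative if $h(xy)\ge h(x)h(y)$ for all $x,y\in J$. Functions $f,g:X\to\mathbb{R}$ are similarly ordered if $(f(x)-f(y))(g(x)-g(y))\ge 0$ for every $x,y\in X$.
   Formalization: The final "=" fails for h=1/2, s=1, f=g=1 on [0,1] (2 versus 1); it is replaced by: the left side is at most the last line, the last line is at most the second, with equality if h is multiplicative on [0,1]. Integrals may be infinite. *)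

theory Defs
  imports "HOL-Analysis.Analysis"
begin

text \<open>The function \<open>h\<close> is only meaningful on its domain \<open>J\<close>, and the class \<open>SX h s I\<close> is used for
  \<open>h\<close> non-negative and not identically zero on \<open>J \<supseteq> [0,1]\<close> and for \<open>0 < s \<le> 1\<close>.  For \<open>s > 0\<close> and
  \<open>h t \<ge> 0\<close>, \<open>h t powr s\<close> is the usual power, including \<open>0 powr s = 0\<close>.\<close>

definition SX :: "(real \<Rightarrow> real) \<Rightarrow> real \<Rightarrow> real set \<Rightarrow> (real \<Rightarrow> real) set" where
  "SX h s I = {f. (\<forall>u\<in>I. 0 \<le> f u) \<and>
     (\<forall>u\<in>I. \<forall>v\<in>I. \<forall>t\<in>{0..1}.
        f (t * u + (1 - t) * v) \<le> h t powr s * f u + h (1 - t) powr s * f v)}"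

text \<open>Both conditions below only speak about products at which \<open>h\<close> is defined.\<close>

definition super_multiplicative_on :: "real set \<Rightarrow> (real \<Rightarrow> real) \<Rightarrow> bool" where
  "super_multiplicative_on J h \<longleftrightarrow>
     (\<forall>x\<in>J. \<forall>y\<in>J. x * y \<in> J \<longrightarrow> h x * h y \<le> h (x * y))"

definition multiplicative_on :: "real set \<Rightarrow> (real \<Rightarrow> real) \<Rightarrow> bool" where
  "multiplicative_on J h \<longleftrightarrow>
     (\<forall>x\<in>J. \<forall>y\<in>J. x * y \<in> J \<longrightarrow> h (x * y) = h x * h y)"

definition similarly_ordered_on :: "'a set \<Rightarrow> ('a \<Rightarrow> real) \<Rightarrow> ('a \<Rightarrow> real) \<Rightarrow> bool" where
  "similarly_ordered_on X f g \<longleftrightarrow> (\<forall>x\<in>X. \<forall>y\<in>X. 0 \<le> (f x - f y) * (g x - g y))"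

text \<open>For a super-multiplicative \<open>h\<close> that is not multiplicative, the two upper bounds
  \<open>M * \<integral> (h^s(t\<^sup>2) + h^s(t - t\<^sup>2)) dt + M * \<integral> (h^s((1-t)\<^sup>2) + h^s(t - t\<^sup>2)) dt\<close> and
  \<open>M * \<integral> (h^s(t) + h^s(1-t))\<^sup>2 dt\<close>, where \<open>M\<close> is the mean of \<open>f g\<close> over \<open>[a,b]\<close>, can differ.
  The lemma records this for \<open>h = 1/2\<close>, \<open>s = 1\<close>, \<open>f = g = 1\<close> on \<open>[a,b] = [0,1]\<close>, where the first
  bound is 2 and the second is 1.\<close>

lemma upper_bounds_can_differ:
  fixes h f g :: "real \<Rightarrow> real" and s a b :: real
  defines "h \<equiv> (\<lambda>_. 1 / 2)" and "f \<equiv> (\<lambda>_. 1)" and "g \<equiv> (\<lambda>_. 1)"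
    and "s \<equiv> 1" and "a \<equiv> 0" and "b \<equiv> 1"
  shows "(\<forall>x. 0 \<le> h x) \<and> (\<forall>x. h x \<noteq> 0) \<and> super_multiplicative_on UNIV h"
    and "f \<in> SX h s {0..} \<and> g \<in> SX h s {0..} \<and> similarly_ordered_on {0..} f g"
    and "f absolutely_integrable_on {a..b} \<and> g absolutely_integrable_on {a..b} \<and>
         (\<lambda>x. f x * g x) absolutely_integrable_on {a..b} \<and> h absolutely_integrable_on {0..1}"
    and "ennreal (1 / (b - a)) * (\<integral>\<^sup>+x\<in>{a..b}. ennreal (f x * g x) \<partial>lebesgue) *
           (\<integral>\<^sup>+t\<in>{0..1}. ennreal (h (t\<^sup>2) powr s + h (t - t\<^sup>2) powr s) \<partial>lebesgue) +
         ennreal (1 / (b - a)) * (\<integral>\<^sup>+y\<in>{a..b}. ennreal (f y * g y) \<partial>lebesgue) *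
           (\<integral>\<^sup>+t\<in>{0..1}. ennreal (h ((1 - t)\<^sup>2) powr s + h (t - t\<^sup>2) powr s) \<partial>lebesgue) = 2"
    and "ennreal (1 / (b - a)) * (\<integral>\<^sup>+x\<in>{a..b}. ennreal (f x * g x) \<partial>lebesgue) *
           (\<integral>\<^sup>+t\<in>{0..1}. ennreal ((h t powr s + h (1 - t) powr s)\<^sup>2) \<partial>lebesgue) = 1"
  unfolding h_def f_def g_def s_def a_def b_def
  by (auto simp: super_multiplicative_on_def SX_def similarly_ordered_on_def
      absolutely_integrable_on_def one_add_one set_integrable_def)

end

theory Submission
  imports Defs
begin

text \<open>Multiplying the two convexity inequalities and replacing \<open>f x * g y + f y * g x\<close> by
  \<open>f x * g x + f y * g y\<close>, which similar ordering allows, bounds the integrand by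
  \<open>p t * f x * g x + p (1 - t) * f y * g y\<close> with \<open>p t = h\<^sup>s t * (h\<^sup>s t + h\<^sup>s (1 - t))\<close>.
  Integration gives the mean of \<open>f g\<close> times \<open>\<integral> (p t + p (1 - t)) dt = \<integral> (h\<^sup>s t + h\<^sup>s (1 - t))\<^sup>2 dt\<close>.
  Super-multiplicativity bounds \<open>p t\<close> by \<open>h\<^sup>s (t\<^sup>2) + h\<^sup>s (t - t\<^sup>2)\<close>.  Monotonicity of the integral needs no
  measurability of the larger function, so nothing has to be known about \<open>h (t\<^sup>2)\<close>
  and \<open>h (t - t\<^sup>2)\<close>.\<close>

text \<open>Expanding the product in the definition gives this two-point rearrangement
  inequality.\<close>

lemma similarly_ordered_onD:
  assumes "similarly_ordered_on X f g" and "x \<in> X" and "y \<in> X"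
  shows "f x * g y + f y * g x \<le> f x * g x + f y * g y"
proof -
  have "0 \<le> (f x - f y) * (g x - g y)"
    using assms unfolding similarly_ordered_on_def by blast
  then show ?thesis
    by (simp add: algebra_simps)
qed

lemma SX_nonneg: "f \<in> SX h s I \<Longrightarrow> u \<in> I \<Longrightarrow> 0 \<le> f u"
  unfolding SX_def by blast

lemma SX_mult_le:
  assumes f: "f \<in> SX h s I" and g: "g \<in> SX h s I"
    and ord: "similarly_ordered_on I f g"
    and I: "x \<in> I" "y \<in> I" "t * x + (1 - t) * y \<in> I" and t: "t \<in> {0..1}"
  defines "p \<equiv> h t powr s" and "q \<equiv> h (1 - t) powr s"
  shows "f (t * x + (1 - t) * y) * g (t * x + (1 - t) * y)
    \<le> (p\<^sup>2 + p * q) * (f x * g x) + (q\<^sup>2 + p * q) * (f y * g y)"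
proof -
  have "f (t * x + (1 - t) * y) \<le> p * f x + q * f y"
    and "g (t * x + (1 - t) * y) \<le> p * g x + q * g y"
    using f g I t unfolding SX_def p_def q_def by blast+
  \<comment> \<open>Two inequalities may be multiplied once the smaller sides are non-negative. For
    this the combination of \<open>x\<close> and \<open>y\<close> must lie in
    \<open>I\<close>.\<close>
  then have "f (t * x + (1 - t) * y) * g (t * x + (1 - t) * y)
      \<le> (p * f x + q * f y) * (p * g x + q * g y)"
    by (intro mult_mono' SX_nonneg[OF f] SX_nonneg[OF g] I)
  also have "\<dots> = p\<^sup>2 * (f x * g x) + q\<^sup>2 * (f y * g y) + p * q * (f x * g y + f y * g x)"
    by (simp add: algebra_simps power2_eq_square)
  also have "\<dots> \<le> p\<^sup>2 * (f x * g x) + q\<^sup>2 * (f y * g y) + p * q * (f x * g x + f y * g y)"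
    by (intro add_left_mono mult_left_mono similarly_ordered_onD[OF ord] I)
      (simp add: p_def q_def)
  finally show ?thesis
    by (simp add: algebra_simps)
qed

lemma super_multiplicative_on_powr_le:
  assumes "super_multiplicative_on J h" and "\<And>x. x \<in> J \<Longrightarrow> 0 \<le> h x" and "0 \<le> s"
    and "x \<in> J" and "y \<in> J" and "x * y \<in> J"
  shows "h x powr s * h y powr s \<le> h (x * y) powr s"
proof -
  have "h x powr s * h y powr s = (h x * h y) powr s"
    using assms by (simp add: powr_mult)
  also have "\<dots> \<le> h (x * y) powr s"
    using assms unfolding super_multiplicative_on_def by (intro powr_mono2) auto
  finally show ?thesis .
qed

lemma multiplicative_on_powr:
  assumes "multiplicative_on J h" and "\<And>x. x \<in> J \<Longrightarrow> 0 \<le> h x"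
    and "x \<in> J" and "y \<in> J" and "x * y \<in> J"
  shows "h (x * y) powr s = h x powr s * h y powr s"
  using assms unfolding multiplicative_on_def by (simp add: powr_mult)

text \<open>Lebesgue measurability survives composition with an affine bijection, because preimages
  of null sets are null; for a general measurable inner map this can fail.\<close>

lemma measurable_lebesgue_reflect:
  fixes k :: "real \<Rightarrow> real"
  assumes "k \<in> borel_measurable lebesgue"
  shows "(\<lambda>t. k (c - t)) \<in> borel_measurable lebesgue"
proof -
  \<comment> \<open>On the real line \<open>Basis\<close> is \<open>{1}\<close>, so this
    coordinatewise scaling by -1 followed by a shift is \<open>c - t\<close>.\<close>
  have "(\<lambda>t. c + (\<Sum>j\<in>Basis. ((- 1) * (t \<bullet> j)) *\<^sub>R j)) \<in> lebesgue \<rightarrow>\<^sub>M (lebesgue :: real measure)"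
    by (rule lebesgue_affine_measurable) simp
  then have "(\<lambda>t. c - t) \<in> lebesgue \<rightarrow>\<^sub>M (lebesgue :: real measure)"
    by simp
  then show ?thesis
    using assms by (rule measurable_compose)
qed

lemma absolutely_integrable_on_nonneg_measurable:
  fixes F :: "real \<Rightarrow> real"
  assumes "F absolutely_integrable_on A"
  shows "(\<lambda>x. ennreal (F x) * indicator A x) \<in> borel_measurable lebesgue"
proof -
  have "(\<lambda>x. ennreal (indicator A x *\<^sub>R F x)) \<in> borel_measurable lebesgue"
    using assms unfolding absolutely_integrable_on_def set_integrable_def
    by (auto dest: borel_measurable_integrable)
  also have "(\<lambda>x. ennreal (indicator A x *\<^sub>R F x)) = (\<lambda>x. ennreal (F x) * indicator A x)"
    by (auto simp: indicator_def)
  finally show ?thesis .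
qed

text \<open>The bound on \<open>K\<close> separates the variables. Integration over \<open>t\<close>
  turns the weights into constants \<open>C\<close> and \<open>D\<close>. Of the two remaining
  integrations, one gives the integral \<open>M\<close> of \<open>F\<close> and the other only the
  length \<open>L\<close> of the interval, so the total is \<open>L * M * (C + D)\<close>.
  Measurability is assumed for the majorant alone, and extended values allow infinite
  integrals.\<close>

lemma nn_integral_average_weighted_le:
  fixes F p q :: "real \<Rightarrow> ennreal" and K :: "real \<Rightarrow> real \<Rightarrow> real \<Rightarrow> ennreal"
  assumes F: "(\<lambda>x. F x * indicator {a..b} x) \<in> borel_measurable lebesgue"
    and p: "(\<lambda>t. p t * indicator T t) \<in> borel_measurable lebesgue"
    and q: "(\<lambda>t. q t * indicator T t) \<in> borel_measurable lebesgue"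
    and "a < b"
    and K: "\<And>x y t. x \<in> {a..b} \<Longrightarrow> y \<in> {a..b} \<Longrightarrow> t \<in> T \<Longrightarrow> K x y t \<le> p t * F x + q t * F y"
  shows "ennreal (1 / (b - a)\<^sup>2) *
      (\<integral>\<^sup>+y\<in>{a..b}. (\<integral>\<^sup>+x\<in>{a..b}. (\<integral>\<^sup>+t\<in>T. K x y t \<partial>lebesgue) \<partial>lebesgue) \<partial>lebesgue)
    \<le> (ennreal (1 / (b - a)) * (\<integral>\<^sup>+x\<in>{a..b}. F x \<partial>lebesgue)) * (\<integral>\<^sup>+t\<in>T. (p t + q t) \<partial>lebesgue)"
proof -
  define C where "C = (\<integral>\<^sup>+t\<in>T. p t \<partial>lebesgue)"
  define D where "D = (\<integral>\<^sup>+t\<in>T. q t \<partial>lebesgue)"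
  define M where "M = (\<integral>\<^sup>+x\<in>{a..b}. F x \<partial>lebesgue)"
  define L where "L = ennreal (b - a)"
  have const: "(\<lambda>x. c * indicator {a..b} x) \<in> borel_measurable lebesgue" for c :: ennreal
    by (intro borel_measurable_times_ennreal borel_measurable_const borel_measurable_indicator) simp
  have inner: "(\<integral>\<^sup>+t\<in>T. K x y t \<partial>lebesgue) \<le> C * F x + D * F y"
    if "x \<in> {a..b}" "y \<in> {a..b}" for x y
  proof -
    have "(\<integral>\<^sup>+t\<in>T. K x y t \<partial>lebesgue)
        \<le> (\<integral>\<^sup>+t. (p t * indicator T t) * F x + (q t * indicator T t) * F y \<partial>lebesgue)"
      using K[OF that] by (intro nn_integral_mono) (auto simp: indicator_def)
    also have "\<dots> = C * F x + D * F y"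
      using p q by (simp add: nn_integral_add nn_integral_multc C_def D_def)
    finally show ?thesis .
  qed
  have middle: "(\<integral>\<^sup>+x\<in>{a..b}. (\<integral>\<^sup>+t\<in>T. K x y t \<partial>lebesgue) \<partial>lebesgue) \<le> C * M + D * F y * L"
    if "y \<in> {a..b}" for y
  proof -
    have "(\<integral>\<^sup>+x\<in>{a..b}. (\<integral>\<^sup>+t\<in>T. K x y t \<partial>lebesgue) \<partial>lebesgue)
        \<le> (\<integral>\<^sup>+x. C * (F x * indicator {a..b} x) + D * F y * indicator {a..b} x \<partial>lebesgue)"
      using inner[OF _ that] by (intro nn_integral_mono) (auto simp: indicator_def)
    also have "\<dots> = C * M + D * F y * L"
      using F \<open>a < b\<close>
      by (subst nn_integral_add)
        (simp_all add: nn_integral_cmult nn_integral_cmult_indicator M_def L_def const)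
    finally show ?thesis .
  qed
  have "(\<integral>\<^sup>+y\<in>{a..b}. (\<integral>\<^sup>+x\<in>{a..b}. (\<integral>\<^sup>+t\<in>T. K x y t \<partial>lebesgue) \<partial>lebesgue) \<partial>lebesgue)
      \<le> (\<integral>\<^sup>+y. C * M * indicator {a..b} y + D * L * (F y * indicator {a..b} y) \<partial>lebesgue)"
    using middle by (intro nn_integral_mono) (auto simp: indicator_def ac_simps)
  also have "\<dots> = C * M * L + D * L * M"
    using F \<open>a < b\<close>
    by (subst nn_integral_add)
      (simp_all add: nn_integral_cmult nn_integral_cmult_indicator M_def L_def const)
  also have "\<dots> = L * M * (C + D)"
    by (simp add: algebra_simps)
  finally have outer:
    "(\<integral>\<^sup>+y\<in>{a..b}. (\<integral>\<^sup>+x\<in>{a..b}. (\<integral>\<^sup>+t\<in>T. K x y t \<partial>lebesgue) \<partial>lebesgue) \<partial>lebesgue)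
      \<le> L * M * (C + D)" .
  \<comment> \<open>The length \<open>L\<close> cancels one of the two factors
    \<open>1 / (b - a)\<close>; the other one makes \<open>M\<close> a mean.\<close>
  have scale: "ennreal (1 / (b - a)\<^sup>2) * L = ennreal (1 / (b - a))"
    using \<open>a < b\<close> by (simp add: L_def ennreal_mult[symmetric] power2_eq_square)
  have CD: "(\<integral>\<^sup>+t\<in>T. (p t + q t) \<partial>lebesgue) = C + D"
    using p q by (simp add: C_def D_def nn_integral_add distrib_right)
  have "ennreal (1 / (b - a)\<^sup>2) *
      (\<integral>\<^sup>+y\<in>{a..b}. (\<integral>\<^sup>+x\<in>{a..b}. (\<integral>\<^sup>+t\<in>T. K x y t \<partial>lebesgue) \<partial>lebesgue) \<partial>lebesgue)
    \<le> ennreal (1 / (b - a)\<^sup>2) * (L * M * (C + D))"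
    by (intro mult_left_mono outer) simp
  also have "\<dots> = (ennreal (1 / (b - a)\<^sup>2) * L) * M * (C + D)"
    by (simp only: mult.assoc)
  finally show ?thesis
    by (simp only: scale CD M_def)
qed

text \<open>The integrals take extended non-negative values because integrability of
  \<open>h\<close> does not make \<open>(h t powr s)\<^sup>2\<close> integrable, so the bounds may
  be infinite. The two bounds are linked by an inequality, and by an equality when \<open>h\<close>
  is multiplicative on \<open>{0..1}\<close>; see \<open>upper_bounds_can_differ\<close>.\<close>

theorem theorem5:
  fixes f g h :: "real \<Rightarrow> real" and J :: "real set" and s a b :: real
  assumes "{0..1} \<subseteq> J" and "\<forall>x\<in>J. 0 \<le> h x" and "\<exists>x\<in>J. h x \<noteq> 0"
    and "0 < s" and "s \<le> 1"
    and "f \<in> SX h s {0..}" and "g \<in> SX h s {0..}"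
    and "super_multiplicative_on J h"
    and "similarly_ordered_on {0..} f g"
    and "a \<in> {0..}" and "b \<in> {0..}" and "a < b"
    and "f absolutely_integrable_on {a..b}" and "g absolutely_integrable_on {a..b}"
    and "(\<lambda>x. f x * g x) absolutely_integrable_on {a..b}"
    and "h absolutely_integrable_on {0..1}"
  shows "let
      lhs = ennreal (1 / (b - a)\<^sup>2) *
        (\<integral>\<^sup>+y\<in>{a..b}. (\<integral>\<^sup>+x\<in>{a..b}. (\<integral>\<^sup>+t\<in>{0..1}.
           ennreal (f (t * x + (1 - t) * y) * g (t * x + (1 - t) * y))
           \<partial>lebesgue) \<partial>lebesgue) \<partial>lebesgue);
      bound1 =
        (ennreal (1 / (b - a)) * (\<integral>\<^sup>+x\<in>{a..b}. ennreal (f x * g x) \<partial>lebesgue)) *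
          (\<integral>\<^sup>+t\<in>{0..1}. ennreal (h (t\<^sup>2) powr s + h (t - t\<^sup>2) powr s) \<partial>lebesgue) +
        (ennreal (1 / (b - a)) * (\<integral>\<^sup>+y\<in>{a..b}. ennreal (f y * g y) \<partial>lebesgue)) *
          (\<integral>\<^sup>+t\<in>{0..1}. ennreal (h ((1 - t)\<^sup>2) powr s + h (t - t\<^sup>2) powr s) \<partial>lebesgue);
      bound2 =
        (ennreal (1 / (b - a)) * (\<integral>\<^sup>+x\<in>{a..b}. ennreal (f x * g x) \<partial>lebesgue)) *
          (\<integral>\<^sup>+t\<in>{0..1}. ennreal ((h t powr s + h (1 - t) powr s)\<^sup>2) \<partial>lebesgue)
    in lhs \<le> bound1 \<and> lhs \<le> bound2 \<and> bound2 \<le> bound1 \<and>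
       (multiplicative_on {0..1} h \<longrightarrow> bound1 = bound2)"
proof -
  define P where "P t = h t powr s" for t
  define p where "p t = (P t)\<^sup>2 + P t * P (1 - t)" for t
  define q where "q t = (P (1 - t))\<^sup>2 + P t * P (1 - t)" for t
  define avg where
    "avg = ennreal (1 / (b - a)) * (\<integral>\<^sup>+x\<in>{a..b}. ennreal (f x * g x) \<partial>lebesgue)"
  have h_nonneg: "0 \<le> h x" if "x \<in> {0..1}" for x
    using assms(1,2) that by blast
  have P_nonneg: "0 \<le> P t" for t
    by (simp add: P_def)
  have pq_nonneg: "0 \<le> p t" "0 \<le> q t" for t
    by (simp_all add: p_def q_def P_nonneg)

  \<comment> \<open>Only the restriction of \<open>h\<close> to \<open>{0..1}\<close> is known to be
    measurable. The cut-off \<open>k\<close> is measurable on the whole line, and since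
    \<open>1 - t\<close> maps \<open>{0..1}\<close> to itself, \<open>k t\<close> and
    \<open>k (1 - t)\<close> agree with \<open>h t\<close> and \<open>h (1 - t)\<close>
    there.\<close>
  define k where "k t = indicator {0..1} t *\<^sub>R h t" for t
  have k [measurable]: "k \<in> borel_measurable lebesgue"
    using assms(16) unfolding absolutely_integrable_on_def set_integrable_def k_def
    by (auto dest: borel_measurable_integrable)
  have k' [measurable]: "(\<lambda>t. k (1 - t)) \<in> borel_measurable lebesgue"
    by (rule measurable_lebesgue_reflect) (rule k)
  have [measurable]: "{0..1::real} \<in> sets lebesgue"
    by simp
  have p_meas: "(\<lambda>t. ennreal (p t) * indicator {0..1} t) \<in> borel_measurable lebesgue"
  proof -
    have "(\<lambda>t. ennreal ((k t powr s)\<^sup>2 + k t powr s * k (1 - t) powr s) * indicator {0..1} t)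
        \<in> borel_measurable lebesgue"
      by measurable
    also have "(\<lambda>t. ennreal ((k t powr s)\<^sup>2 + k t powr s * k (1 - t) powr s) * indicator {0..1} t)
        = (\<lambda>t. ennreal (p t) * indicator {0..1} t)"
      by (auto simp: k_def p_def P_def indicator_def)
    finally show ?thesis .
  qed
  have q_meas: "(\<lambda>t. ennreal (q t) * indicator {0..1} t) \<in> borel_measurable lebesgue"
  proof -
    have "(\<lambda>t. ennreal ((k (1 - t) powr s)\<^sup>2 + k t powr s * k (1 - t) powr s) * indicator {0..1} t)
        \<in> borel_measurable lebesgue"
      by measurable
    also have "(\<lambda>t. ennreal ((k (1 - t) powr s)\<^sup>2 + k t powr s * k (1 - t) powr s) * indicator {0..1} t)
        = (\<lambda>t. ennreal (q t) * indicator {0..1} t)"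
      by (auto simp: k_def q_def P_def indicator_def)
    finally show ?thesis .
  qed

  have pq: "ennreal (p t) + ennreal (q t) = ennreal ((P t + P (1 - t))\<^sup>2)" for t
    using pq_nonneg[of t]
    by (simp add: ennreal_plus[symmetric] p_def q_def power2_eq_square algebra_simps del: ennreal_plus)
  have bound: "ennreal (f (t * x + (1 - t) * y) * g (t * x + (1 - t) * y))
      \<le> ennreal (p t) * ennreal (f x * g x) + ennreal (q t) * ennreal (f y * g y)"
    if "x \<in> {a..b}" "y \<in> {a..b}" "t \<in> {0..1}" for x y t
  proof -
    have I: "x \<in> {0..}" "y \<in> {0..}" "t * x + (1 - t) * y \<in> {0..}"
      using that assms(10) by auto
    have fg: "0 \<le> f x * g x" "0 \<le> f y * g y"
      using SX_nonneg[OF assms(6)] SX_nonneg[OF assms(7)] I by simp_all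
    have "f (t * x + (1 - t) * y) * g (t * x + (1 - t) * y)
        \<le> p t * (f x * g x) + q t * (f y * g y)"
      using SX_mult_le[OF assms(6,7,9) I that(3)] by (simp only: p_def q_def P_def)
    then show ?thesis
      using fg pq_nonneg[of t]
      by (simp add: ennreal_mult'[symmetric] ennreal_plus[symmetric] ennreal_leI del: ennreal_plus)
  qed
  have lhs: "ennreal (1 / (b - a)\<^sup>2) *
        (\<integral>\<^sup>+y\<in>{a..b}. (\<integral>\<^sup>+x\<in>{a..b}. (\<integral>\<^sup>+t\<in>{0..1}.
           ennreal (f (t * x + (1 - t) * y) * g (t * x + (1 - t) * y))
           \<partial>lebesgue) \<partial>lebesgue) \<partial>lebesgue)
      \<le> avg * (\<integral>\<^sup>+t\<in>{0..1}. ennreal ((P t + P (1 - t))\<^sup>2) \<partial>lebesgue)"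
    using nn_integral_average_weighted_le
        [OF absolutely_integrable_on_nonneg_measurable[OF assms(15)] p_meas q_meas assms(12) bound]
    unfolding pq avg_def .

  \<comment> \<open>Each argument \<open>t\<^sup>2\<close>, \<open>(1 - t)\<^sup>2\<close>,
    \<open>t - t\<^sup>2\<close> is a product of two factors from \<open>t\<close> and
    \<open>1 - t\<close> and stays in \<open>{0..1}\<close>, so super-multiplicativity applies to
    every term of \<open>p t\<close> and \<open>q t\<close>.\<close>
  have sq: "t - t\<^sup>2 = t * (1 - t)" for t :: real
    by (simp add: power2_eq_square algebra_simps)
  have unit: "t \<in> {0..1}" "1 - t \<in> {0..1}" "t * t \<in> {0..1}"
      "(1 - t) * (1 - t) \<in> {0..1}" "t * (1 - t) \<in> {0..1}" if "t \<in> {0..1}" for t :: real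
    using that by (auto intro: mult_le_one)
  have super: "P x * P y \<le> P (x * y)"
    if "x \<in> {0..1}" "y \<in> {0..1}" "x * y \<in> {0..1}" for x y
    unfolding P_def using assms(1,2,4,8) that
    by (intro super_multiplicative_on_powr_le[of J]) auto
  have p_le: "p t \<le> P (t\<^sup>2) + P (t - t\<^sup>2)" and q_le: "q t \<le> P ((1 - t)\<^sup>2) + P (t - t\<^sup>2)"
    if "t \<in> {0..1}" for t
    unfolding p_def q_def sq unfolding power2_eq_square
    by (intro add_mono super unit[OF that])+
  \<comment> \<open>Additivity is used on the smaller side, where \<open>p\<close> and
    \<open>q\<close> are measurable. The larger side is already a sum of two integrals, and each is
    compared by monotonicity.\<close>
  have split: "(\<integral>\<^sup>+t\<in>{0..1}. ennreal ((P t + P (1 - t))\<^sup>2) \<partial>lebesgue)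
      = (\<integral>\<^sup>+t\<in>{0..1}. ennreal (p t) \<partial>lebesgue) + (\<integral>\<^sup>+t\<in>{0..1}. ennreal (q t) \<partial>lebesgue)"
    using p_meas q_meas by (simp add: pq[symmetric] distrib_right nn_integral_add)
  have bounds: "avg * (\<integral>\<^sup>+t\<in>{0..1}. ennreal ((P t + P (1 - t))\<^sup>2) \<partial>lebesgue)
      \<le> avg * (\<integral>\<^sup>+t\<in>{0..1}. ennreal (P (t\<^sup>2) + P (t - t\<^sup>2)) \<partial>lebesgue)
        + avg * (\<integral>\<^sup>+t\<in>{0..1}. ennreal (P ((1 - t)\<^sup>2) + P (t - t\<^sup>2)) \<partial>lebesgue)"
    unfolding split distrib_left
    by (intro add_mono mult_left_mono nn_integral_mono)
      (auto simp: indicator_def intro!: ennreal_leI p_le q_le)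
  \<comment> \<open>Under multiplicativity the estimates \<open>p_le\<close> and \<open>q_le\<close>
    become pointwise equalities on \<open>{0..1}\<close>, so the integrals agree by congruence,
    again without measurability of the left integrands.\<close>
  have equality: "avg * (\<integral>\<^sup>+t\<in>{0..1}. ennreal (P (t\<^sup>2) + P (t - t\<^sup>2)) \<partial>lebesgue)
        + avg * (\<integral>\<^sup>+t\<in>{0..1}. ennreal (P ((1 - t)\<^sup>2) + P (t - t\<^sup>2)) \<partial>lebesgue)
      = avg * (\<integral>\<^sup>+t\<in>{0..1}. ennreal ((P t + P (1 - t))\<^sup>2) \<partial>lebesgue)"
    if mult: "multiplicative_on {0..1} h"
  proof -
    have P_mult: "P (x * y) = P x * P y"
      if "x \<in> {0..1}" "y \<in> {0..1}" "x * y \<in> {0..1}" for x y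
      unfolding P_def using multiplicative_on_powr[OF mult h_nonneg] that by blast
    have p_eq: "P (t\<^sup>2) + P (t - t\<^sup>2) = p t" and q_eq: "P ((1 - t)\<^sup>2) + P (t - t\<^sup>2) = q t"
      if "t \<in> {0..1}" for t
      unfolding p_def q_def sq unfolding power2_eq_square
      using unit[OF that] by (simp_all only: P_mult)
    have "(\<integral>\<^sup>+t\<in>{0..1}. ennreal (P (t\<^sup>2) + P (t - t\<^sup>2)) \<partial>lebesgue)
          = (\<integral>\<^sup>+t\<in>{0..1}. ennreal (p t) \<partial>lebesgue)"
      and "(\<integral>\<^sup>+t\<in>{0..1}. ennreal (P ((1 - t)\<^sup>2) + P (t - t\<^sup>2)) \<partial>lebesgue)
          = (\<integral>\<^sup>+t\<in>{0..1}. ennreal (q t) \<partial>lebesgue)"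
      by (intro nn_integral_cong; simp add: indicator_def p_eq q_eq)+
    then show ?thesis
      by (simp only: split distrib_left)
  qed
  show ?thesis
    using lhs bounds order_trans[OF lhs bounds] equality
    unfolding Let_def P_def avg_def by blast
qed

end
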